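(* Let $0<p<\infty$, let $B_1,B_2$ be two arbitrary Blaschke products and let $\phi$ be a holomorphic self map of the open unit disk $\mathbb{D}$. Then $C_\phi(B_1H^p)\subseteq B_2H^p$ if and only if $\mathrm{mult}_{B_2}(w)\le\mathrm{mult}_{B_1\circ\phi}(w)$ for all $w\in Z(B_2)$.
   Context: A Blaschke product is a function $B(z)=\gamma z^m\prod_i\frac{|a_i|}{a_i}\frac{a_i-z}{1-\overline{a_i}z}$ with $|\gamma|=1$, $m\in\mathbb{N}\cup\{0\}$ and $\{a_i\}\subseteq\mathbb{D}\setminus\{0\}$ a (possibly finite) sequence with $\sum_i(1-|a_i|)<\infty$. $Z(f)$ is the set of zeros of $f$ in $\mathbb{D}$ and $\mathrm{mult}_f(w)$ is the order of vanishing of $f$ at $w$, equal to $0$ if $f(w)\ne0$ and to $\infty$ if $f\equiv0$. $H^p$ is the Hardy space on $\mathbb{D}$, $BH^p=\{Bf:f\in H^p\}$, and $C_\phi(f)=f\circ\phi$. *)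

theory Defs
  imports "HOL-Complex_Analysis.Complex_Analysis"
begin

text \<open>
  Functions on the open unit disk are total functions of type \<^typ>\<open>complex \<Rightarrow> complex\<close> whose values
  outside \<^term>\<open>ball (0::complex) 1\<close> are irrelevant: every notion below depends only on the values
  on the disk.
\<close>

definition blaschke_factor :: "complex \<Rightarrow> complex \<Rightarrow> complex" where
  "blaschke_factor a z = complex_of_real (norm a) / a * ((a - z) / (1 - cnj a * z))"

text \<open>
  The index set \<open>I\<close> is an arbitrary set of natural numbers, so that the zero sequence may be empty,
  finite or infinite, and may have repetitions; indices outside \<open>I\<close> contribute the factor 1.
  The infinite product is the one of the library, whose value is 0 at the (finitely many)
  vanishing factors.
\<close>

definition blaschke_product :: "(complex \<Rightarrow> complex) \<Rightarrow> bool" where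
  "blaschke_product B \<longleftrightarrow>
     (\<exists>(\<gamma>::complex) (m::nat) (I::nat set) (a::nat \<Rightarrow> complex).
        norm \<gamma> = 1 \<and>
        (\<forall>i\<in>I. a i \<in> ball 0 1 - {0}) \<and>
        (\<lambda>i. 1 - norm (a i)) summable_on I \<and>
        (\<forall>z\<in>ball 0 1. B z = \<gamma> * z ^ m * prodinf (\<lambda>i. if i \<in> I then blaschke_factor (a i) z else 1)))"

definition hardy_space :: "real \<Rightarrow> (complex \<Rightarrow> complex) set" where
  "hardy_space p =
     {f. f holomorphic_on ball 0 1 \<and>
         bdd_above ((\<lambda>r. 1 / (2 * pi) *
            integral {0..2 * pi} (\<lambda>t. norm (f (complex_of_real r * cis t)) powr p)) ` {0<..<1})}"

text \<open>The space \<open>B H\<^sup>p\<close>, the product being taken on the disk only.\<close>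

definition blaschke_hardy :: "(complex \<Rightarrow> complex) \<Rightarrow> real \<Rightarrow> (complex \<Rightarrow> complex) set" where
  "blaschke_hardy B p = {g. \<exists>f\<in>hardy_space p. \<forall>z\<in>ball 0 1. g z = B z * f z}"

definition composition_operator ::
    "(complex \<Rightarrow> complex) \<Rightarrow> (complex \<Rightarrow> complex) \<Rightarrow> (complex \<Rightarrow> complex)" where
  "composition_operator \<phi> f = f \<circ> \<phi>"

definition disk_zeros :: "(complex \<Rightarrow> complex) \<Rightarrow> complex set" where
  "disk_zeros f = {z \<in> ball 0 1. f z = 0}"

text \<open>
  For \<open>f\<close> holomorphic on the disk and \<open>w\<close> in the disk. The first case is separate because \<^const>\<open>zorder\<close>
  is unspecified for functions vanishing identically near \<open>w\<close>.
\<close>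

definition zero_mult :: "(complex \<Rightarrow> complex) \<Rightarrow> complex \<Rightarrow> enat" where
  "zero_mult f w =
     (if \<forall>z\<in>ball 0 1. f z = 0 then \<infinity>
      else if f w \<noteq> 0 then 0
      else enat (nat (zorder f w)))"

end

theory Submission
  imports Defs
begin

text \<open>
  The multiplicity condition says exactly that \<open>B\<^sub>2\<close> divides \<open>B\<^sub>1 \<circ> \<phi>\<close> in the ring of holomorphic
  functions on the disk (\<open>zero_mult_le_iff_divides\<close>). If the inclusion holds, apply it to
  \<open>B\<^sub>1 = B\<^sub>1 \<cdot> 1\<close>: the quotient that witnesses \<open>B\<^sub>1 \<circ> \<phi> \<in> B\<^sub>2 H\<^sup>p\<close> is holomorphic. Conversely, write
  \<open>B\<^sub>1 \<circ> \<phi> = B\<^sub>2 Q\<close>. For \<open>f\<close> in \<open>H\<^sup>p\<close> then \<open>(B\<^sub>1 f) \<circ> \<phi> = B\<^sub>2 G\<close> with \<open>G = Q (f \<circ> \<phi>)\<close>, and it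
  remains to see that \<open>G\<close> is in \<open>H\<^sup>p\<close>. This takes two classical theorems: Littlewood's, that
  \<open>f \<circ> \<phi>\<close> is in \<open>H\<^sup>p\<close>, so that \<open>B\<^sub>2 G\<close> is too because \<open>\<bar>B\<^sub>1\<bar> \<le> 1\<close>; and Riesz's, that a Blaschke
  product can be divided out without leaving \<open>H\<^sup>p\<close>.

  Both rest on one estimate, the sub-Poisson inequality for \<open>\<bar>f\<bar>\<^sup>p\<close> on a circle \<open>\<bar>z\<bar> = R\<close> that carries
  no zeros of \<open>f\<close>. The finitely many zeros inside are moved across the circle by Blaschke factors
  of the disc of radius \<open>R\<close>, which keeps \<open>\<bar>f\<bar>\<close> on the circle and does not decrease it inside. The
  resulting function has no zeros, so its \<open>p\<close>-th power is holomorphic, whatever the exponent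
  \<open>p > 0\<close>, and Cauchy's formula applies to it. Integrating the inequality along \<open>\<phi>\<close> of a smaller
  circle gives the subordination estimate \<open>circle_mean_comp_le\<close>, since the Poisson kernel composed
  with \<open>\<phi>\<close> is the real part of a holomorphic function and has the mean value property. For
  \<open>\<phi> = id\<close> the estimate says that the means over circles grow with the radius.

  For Riesz's theorem, write \<open>B = P\<^sub>n T\<^sub>n\<close> with a finite Blaschke product \<open>P\<^sub>n\<close> and a tail \<open>T\<^sub>n\<close>.
  Near the unit circle \<open>\<bar>P\<^sub>n\<bar>\<close> is close to 1, so \<open>T\<^sub>n G = B G / P\<^sub>n\<close> has means over large circles that are
  hardly larger than those of \<open>B G\<close>, hence means over all circles no larger than the bound for
  \<open>B G\<close>. As \<open>n\<close> grows, \<open>T\<^sub>n\<close> tends to 1 and \<open>T\<^sub>n G\<close> to \<open>G\<close>, dominated by \<open>\<bar>G\<bar>\<close>.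
\<close>

section \<open>Divisibility of holomorphic functions\<close>

text \<open>
  Near a zero \<open>w\<close> of \<open>B\<close> the quotient is a non-vanishing factor times \<open>(z - w)\<close> to the difference
  of the orders, a nonnegative power; so all singularities of \<open>F / B\<close> are removable.
\<close>

lemma holomorphic_divides_if_zorder_le:
  fixes F B :: "complex \<Rightarrow> complex"
  assumes S: "open S" "connected S" and F: "F holomorphic_on S" and B: "B holomorphic_on S"
    and "\<exists>z\<in>S. F z \<noteq> 0" and "\<exists>z\<in>S. B z \<noteq> 0"
    and ord: "\<And>w. w \<in> S \<Longrightarrow> B w = 0 \<Longrightarrow> zorder B w \<le> zorder F w"
  shows "\<exists>Q. Q holomorphic_on S \<and> (\<forall>z\<in>S. F z = B z * Q z)"
proof -
  define q where "q = (\<lambda>z. F z / B z)"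
  define Q where "Q = remove_sings q"
  have an: "q analytic_on {z}" if "z \<in> S" "B z \<noteq> 0" for z
    unfolding q_def using that F B S(1)
    by (intro analytic_on_divide) (auto simp: analytic_at)
  have zero: "F w = 0 \<and> Q analytic_on {w}" if w: "w \<in> S" "B w = 0" for w
  proof -
    define m n where "m = nat (zorder F w)" and "n = nat (zorder B w)"
    obtain r1 where r1: "r1 > 0" "\<And>u. u \<in> cball w r1 \<Longrightarrow> F u = zor_poly F w u * (u - w) ^ m"
      "zor_poly F w holomorphic_on cball w r1" and F0: "F w \<noteq> 0 \<longleftrightarrow> zorder F w = 0"
      using zorder_exist_zero[OF F S w(1) assms(5)] unfolding m_def by (metis less_irrefl)
    obtain r2 where r2: "r2 > 0" "cball w r2 \<subseteq> S"
      "\<And>u. u \<in> cball w r2 \<Longrightarrow> B u = zor_poly B w u * (u - w) ^ n"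
      "\<And>u. u \<in> cball w r2 \<Longrightarrow> zor_poly B w u \<noteq> 0"
      "zor_poly B w holomorphic_on cball w r2" and B0: "zorder B w > 0"
      using zorder_exist_zero[OF B S w(1) assms(6)] w(2) unfolding n_def by metis
    have mn: "n \<le> m" using ord[OF w] unfolding m_def n_def by simp
    define r where "r = min r1 r2"
    have r: "r > 0" using r1(1) r2(1) by (simp add: r_def)
    define k where "k = (\<lambda>u. zor_poly F w u / zor_poly B w u * (u - w) ^ (m - n))"
    have k: "k holomorphic_on ball w r"
      unfolding k_def using r2(4)
      by (intro holomorphic_intros holomorphic_on_subset[OF r1(3)] holomorphic_on_subset[OF r2(5)])
         (auto simp: r_def)
    have eq: "q u = k u" if "u \<in> ball w r" "u \<noteq> w" for u
    proof -
      have "(u - w) ^ m = (u - w) ^ (m - n) * (u - w) ^ n"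
        using mn by (metis le_add_diff_inverse2 power_add)
      thus ?thesis
        using that r1(2)[of u] r2(3)[of u] r2(4)[of u] by (simp add: q_def k_def r_def)
    qed
    have ev: "eventually (\<lambda>u. q u = k u) (at w)"
      using eventually_at_ball'[OF r, of w UNIV] by eventually_elim (use eq in auto)
    have "k \<midarrow>w\<rightarrow> k w"
      using k r continuous_on_eq_continuous_at[of "ball w r" k] 
      by (simp add: holomorphic_on_imp_continuous_on isCont_def)
    hence lim: "q \<midarrow>w\<rightarrow> k w" using ev by (simp cong: tendsto_cong)
    have "isolated_singularity_at k w"
      using k r by (intro isolated_singularity_at_holomorphic[of _ "ball w r"])
        (auto intro: holomorphic_on_subset)
    hence "isolated_singularity_at q w"
      using isolated_singularity_at_cong[OF ev refl] by simp
    from remove_sings_analytic_at[OF this lim] show ?thesis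
      using F0 B0 ord[OF w] by (auto simp: Q_def)
  qed
  have "Q analytic_on {z}" if "z \<in> S" for z
  proof (cases "B z = 0")
    case False
    thus ?thesis using an[OF that] unfolding Q_def by (simp add: remove_sings_analytic_on)
  qed (use zero that in auto)
  hence "Q holomorphic_on S"
    using analytic_imp_holomorphic analytic_on_analytic_at by blast
  moreover have "F z = B z * Q z" if "z \<in> S" for z
    using zero[OF that] an[OF that] by (cases "B z = 0") (auto simp: Q_def q_def)
  ultimately show ?thesis by blast
qed

lemma zorder_times_holomorphic:
  fixes B Q :: "complex \<Rightarrow> complex"
  assumes S: "open S" "connected S" "w \<in> S" and B: "B holomorphic_on S" and Q: "Q holomorphic_on S"
    and nz: "\<exists>z\<in>S. B z * Q z \<noteq> 0"
  shows "zorder (\<lambda>z. B z * Q z) w = zorder B w + zorder Q w"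
proof -
  have h: "(\<lambda>z. B z * Q z) holomorphic_on S" by (intro holomorphic_intros B Q)
  have "eventually (\<lambda>z. B z * Q z \<noteq> 0) (at w)"
    using non_zero_neighbour_alt[OF h S] nz by (metis (mono_tags, lifting) eventually_mono)
  hence "\<exists>\<^sub>F z in at w. B z * Q z \<noteq> 0"
    by (intro eventually_frequently) auto
  moreover have "B analytic_on {w}" "Q analytic_on {w}"
    using B Q S by (auto simp: analytic_at)
  ultimately show ?thesis
    by (intro zorder_times_analytic') (auto intro: isolated_singularity_at_analytic not_essential_analytic)
qed

text \<open>
  The convention that the zero function has infinite multiplicity matches its being divisible by
  everything.
\<close>

lemma zero_mult_le_iff_divides:
  assumes F: "F holomorphic_on ball 0 1" and B: "B holomorphic_on ball 0 1"
    and B0: "\<exists>z\<in>ball 0 1. B z \<noteq> 0"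
  shows "(\<forall>w\<in>disk_zeros B. zero_mult B w \<le> zero_mult F w) \<longleftrightarrow>
         (\<exists>Q. Q holomorphic_on ball 0 1 \<and> (\<forall>z\<in>ball 0 1. F z = B z * Q z))"
proof (cases "\<forall>z\<in>ball 0 1. F z = 0")
  case True
  thus ?thesis by (auto simp: zero_mult_def intro!: exI[of _ "\<lambda>_. 0"])
next
  case False
  hence F0: "\<exists>z\<in>ball 0 1. F z \<noteq> 0" by blast
  have S: "open (ball (0::complex) 1)" "connected (ball (0::complex) 1)" by auto
  show ?thesis
  proof
    assume L: "\<forall>w\<in>disk_zeros B. zero_mult B w \<le> zero_mult F w"
    have "zorder B w \<le> zorder F w" if w: "w \<in> ball 0 1" "B w = 0" for w
    proof -
      have "zorder B w > 0" using zorder_exist_zero[OF B S w(1) B0] w(2) by auto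
      moreover have "enat (nat (zorder B w)) \<le> (if F w \<noteq> 0 then 0 else enat (nat (zorder F w)))"
      proof -
        have "\<not> (\<forall>z\<in>ball 0 1. B z = 0)" using B0 by blast
        moreover have "zero_mult B w \<le> zero_mult F w" using L w by (simp add: disk_zeros_def)
        ultimately show ?thesis using w(2) False unfolding zero_mult_def by (simp only: if_False) simp
      qed
      ultimately show ?thesis by (auto split: if_splits simp: zero_enat_def)
    qed
    thus "\<exists>Q. Q holomorphic_on ball 0 1 \<and> (\<forall>z\<in>ball 0 1. F z = B z * Q z)"
      by (rule holomorphic_divides_if_zorder_le[OF S F B F0 B0])
  next
    assume "\<exists>Q. Q holomorphic_on ball 0 1 \<and> (\<forall>z\<in>ball 0 1. F z = B z * Q z)"
    then obtain Q where Q: "Q holomorphic_on ball 0 1" "\<And>z. z \<in> ball 0 1 \<Longrightarrow> F z = B z * Q z"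
      by blast
    show "\<forall>w\<in>disk_zeros B. zero_mult B w \<le> zero_mult F w"
    proof
      fix w assume "w \<in> disk_zeros B"
      hence w: "w \<in> ball 0 1" "B w = 0" by (auto simp: disk_zeros_def)
      have "\<forall>\<^sub>F z in nhds w. z \<in> ball 0 1"
        using w(1) by (intro eventually_nhds_in_open) auto
      hence "\<forall>\<^sub>F z in at w. F z = B z * Q z"
        unfolding eventually_at_filter by eventually_elim (use Q(2) in auto)
      hence "zorder F w = zorder (\<lambda>z. B z * Q z) w" by (rule zorder_cong) auto
      also have "\<dots> = zorder B w + zorder Q w"
        using F0 Q(2) by (intro zorder_times_holomorphic[OF S w(1) B Q(1)]) auto
      also have "\<dots> \<ge> zorder B w"
      proof -
        have "\<exists>z\<in>ball 0 1. Q z \<noteq> 0" using F0 Q(2) by auto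
        from zorder_exist_zero[OF Q(1) S w(1) this] show ?thesis by (auto split: if_splits)
      qed
      finally have "zorder B w \<le> zorder F w" .
      moreover have "F w = 0" using Q(2) w by auto
      ultimately show "zero_mult B w \<le> zero_mult F w"
        using w False B0 by (auto simp: zero_mult_def)
    qed
  qed
qed

section \<open>The sub-Poisson inequality for powers of the modulus\<close>

text \<open>Cauchy's formula in the angular variable; for \<open>w = 0\<close> it is the mean value property.\<close>

lemma Cauchy_integral_circle_angle:
  assumes k: "continuous_on (cball 0 R) k" "k holomorphic_on ball 0 R" and w: "norm w < R"
  shows "((\<lambda>t. k (of_real R * cis t) * (of_real R * cis t / (of_real R * cis t - w)))
           has_integral of_real (2 * pi) * k w) {0..2 * pi}"
proof -
  have "((\<lambda>u. k u / (u - w)) has_contour_integral (2 * of_real pi * \<i> * k w)) (circlepath 0 R)"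
    using Cauchy_integral_circlepath[OF k, of w] w by simp
  hence "((\<lambda>t. k (0 + of_real R * cis t) / (0 + of_real R * cis t - w) * of_real R * \<i> * cis t)
            has_integral (2 * of_real pi * \<i> * k w)) {0..2 * pi}"
    unfolding circlepath_def by (subst (asm) has_contour_integral_part_circlepath_iff) auto
  from has_integral_mult_right[OF this, of "-\<i>"] show ?thesis
    by (simp add: mult_ac)
qed

text \<open>
  The kernel of the disc with centre 0 through the boundary point \<open>\<zeta>\<close>, without the factor
  \<open>1 / (2 \<pi>)\<close>.
\<close>

definition poisson_kernel :: "complex \<Rightarrow> complex \<Rightarrow> real" where
  "poisson_kernel w \<zeta> = ((norm \<zeta>)\<^sup>2 - (norm w)\<^sup>2) / (norm (\<zeta> - w))\<^sup>2"

text \<open>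
  This form shows that the kernel is harmonic in \<open>w\<close>, and stays so after composition with a
  holomorphic function.
\<close>

lemma poisson_kernel_eq_Re: "poisson_kernel w \<zeta> = Re ((\<zeta> + w) / (\<zeta> - w))"
proof -
  have "(\<zeta> + w) / (\<zeta> - w) = (\<zeta> + w) * cnj (\<zeta> - w) / of_real ((norm (\<zeta> - w))\<^sup>2)"
    by (simp add: complex_div_cnj[of "\<zeta> + w"])
  moreover have "Re ((\<zeta> + w) * cnj (\<zeta> - w)) = (norm \<zeta>)\<^sup>2 - (norm w)\<^sup>2"
    unfolding cmod_power2 by (simp add: power2_eq_square algebra_simps)
  ultimately show ?thesis
    unfolding poisson_kernel_def by (metis Re_divide_of_real)
qed

lemma poisson_kernel_le:
  assumes "norm w < norm \<zeta>"
  shows "poisson_kernel w \<zeta> \<le> (norm \<zeta> + norm w) / (norm \<zeta> - norm w)"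
proof -
  have "norm \<zeta> - norm w \<le> norm (\<zeta> - w)" by (rule norm_triangle_ineq2)
  hence "poisson_kernel w \<zeta> \<le> ((norm \<zeta>)\<^sup>2 - (norm w)\<^sup>2) / (norm \<zeta> - norm w)\<^sup>2"
    unfolding poisson_kernel_def using assms
    by (intro divide_left_mono power_mono mult_pos_pos) (auto simp: power_mono)
  also have "\<dots> = (norm \<zeta> + norm w) / (norm \<zeta> - norm w)"
    using assms by (simp add: power2_eq_square square_diff_square_factored)
  finally show ?thesis .
qed

text \<open>
  The function \<open>k\<close> is multiplied by a factor \<open>m\<close> that is holomorphic on the disc and equal to 1 at
  \<open>w\<close>, chosen so that the modulus of the Cauchy kernel times \<open>m\<close> is the Poisson kernel on the
  circle. The bound is then the triangle inequality in Cauchy's formula.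
\<close>

lemma norm_le_poisson_integral:
  assumes k: "continuous_on (cball 0 R) k" "k holomorphic_on ball 0 R" and w: "norm w < R"
  shows "2 * pi * norm (k w) \<le>
           integral {0..2 * pi} (\<lambda>t. poisson_kernel w (of_real R * cis t) * norm (k (of_real R * cis t)))"
proof -
  have R: "R > 0" using w norm_ge_zero[of w] by linarith
  define c where "c = complex_of_real (R\<^sup>2 - (norm w)\<^sup>2)"
  define m where "m = (\<lambda>z. c / (of_real (R\<^sup>2) - cnj w * z))"
  have nz: "of_real (R\<^sup>2) - cnj w * z \<noteq> 0" if "z \<in> cball 0 R" for z
  proof
    assume "of_real (R\<^sup>2) - cnj w * z = 0"
    hence "norm (cnj w * z) = norm (of_real (R\<^sup>2) :: complex)" by simp
    hence "norm w * norm z = R\<^sup>2" by (simp add: norm_mult norm_power)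
    moreover have "norm w * norm z \<le> norm w * R" using that by (intro mult_left_mono) auto
    moreover have "norm w * R < R * R" using w R by (intro mult_strict_right_mono) auto
    ultimately show False by (simp add: power2_eq_square)
  qed
  define K where "K = (\<lambda>z. k z * m z)"
  have K: "continuous_on (cball 0 R) K" "K holomorphic_on ball 0 R"
    unfolding K_def m_def
     apply (intro continuous_intros k) using nz apply auto[1]
    apply (intro holomorphic_intros k) using nz by auto
  have "m w = 1"
  proof -
    have "cnj w * w = of_real ((norm w)\<^sup>2)" by (simp only: complex_norm_square mult.commute)
    thus ?thesis using nz[of w] w unfolding m_def c_def by simp
  qed
  hence I: "((\<lambda>t. K (of_real R * cis t) * (of_real R * cis t / (of_real R * cis t - w)))
           has_integral of_real (2 * pi) * k w) {0..2 * pi}"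
    using Cauchy_integral_circle_angle[OF K w] by (simp add: K_def)
  have ne: "of_real R * cis t - w \<noteq> 0" for t
  proof
    assume "of_real R * cis t - w = 0"
    hence "norm w = norm (of_real R * cis t)" by simp
    thus False using w R by (simp add: norm_mult)
  qed
  have eq: "norm (K (of_real R * cis t) * (of_real R * cis t / (of_real R * cis t - w)))
      = poisson_kernel w (of_real R * cis t) * norm (k (of_real R * cis t))" for t
  proof -
    define \<zeta> where "\<zeta> = of_real R * cis t"
    have n: "norm \<zeta> = R" using R by (simp add: \<zeta>_def norm_mult)
    have "\<zeta> * cnj \<zeta> = of_real (R\<^sup>2)" using complex_norm_square[of \<zeta>] n by simp
    hence "of_real (R\<^sup>2) - cnj w * \<zeta> = \<zeta> * cnj (\<zeta> - w)" by (simp add: algebra_simps)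
    hence "norm (of_real (R\<^sup>2) - cnj w * \<zeta>) = R * norm (\<zeta> - w)"
      using n by (metis complex_mod_cnj norm_mult)
    moreover have "norm c = R\<^sup>2 - (norm w)\<^sup>2"
      unfolding c_def norm_of_real using w by (simp add: power_mono)
    ultimately have "norm (K \<zeta> * (\<zeta> / (\<zeta> - w))) = poisson_kernel w \<zeta> * norm (k \<zeta>)"
      using R n by (simp add: K_def m_def norm_mult norm_divide poisson_kernel_def power2_eq_square)
    thus ?thesis by (simp add: \<zeta>_def)
  qed
  have cont: "continuous_on {0..2 * pi} (\<lambda>t. poisson_kernel w (of_real R * cis t) * norm (k (of_real R * cis t)))"
    unfolding poisson_kernel_def using ne R
    by (intro continuous_intros continuous_on_compose2[OF k(1)]) (auto simp: norm_mult)
  have "norm (of_real (2 * pi) * k w) \<le>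
           integral {0..2 * pi} (\<lambda>t. poisson_kernel w (of_real R * cis t) * norm (k (of_real R * cis t)))"
    unfolding integral_unique[OF I, symmetric]
    by (rule integral_norm_bound_integral[OF has_integral_integrable[OF I]
          integrable_continuous_interval[OF cont]]) (use eq in auto)
  thus ?thesis by (simp add: norm_mult)
qed

text \<open>
  The quotient of the two sides is the modulus of the Blaschke factor at \<open>a\<close> of the disc of radius
  \<open>R\<close>.
\<close>

lemma norm_diff_le_reflected:
  assumes "norm a \<le> R" "norm z \<le> R"
  shows "R * norm (z - a) \<le> norm (of_real (R\<^sup>2) - cnj a * z)"
    and "norm z = R \<Longrightarrow> R * norm (z - a) = norm (of_real (R\<^sup>2) - cnj a * z)"
proof -
  have R: "R \<ge> 0" using assms(1) norm_ge_zero order_trans by blast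
  have eq: "(norm (of_real (R\<^sup>2) - cnj a * z))\<^sup>2 - (R * norm (z - a))\<^sup>2
              = (R\<^sup>2 - (norm a)\<^sup>2) * (R\<^sup>2 - (norm z)\<^sup>2)"
    unfolding power_mult_distrib cmod_power2
    by (simp add: power2_eq_square algebra_simps)
  have "(norm a)\<^sup>2 \<le> R\<^sup>2" "(norm z)\<^sup>2 \<le> R\<^sup>2"
    using power_mono[OF assms(1) norm_ge_zero] power_mono[OF assms(2) norm_ge_zero] by blast+
  hence "0 \<le> (R\<^sup>2 - (norm a)\<^sup>2) * (R\<^sup>2 - (norm z)\<^sup>2)" by simp
  with eq have "(R * norm (z - a))\<^sup>2 \<le> (norm (of_real (R\<^sup>2) - cnj a * z))\<^sup>2" by linarith
  thus "R * norm (z - a) \<le> norm (of_real (R\<^sup>2) - cnj a * z)"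
    by (rule power2_le_imp_le) (rule norm_ge_zero)
  assume "norm z = R"
  with eq have "(norm (of_real (R\<^sup>2) - cnj a * z))\<^sup>2 = (R * norm (z - a))\<^sup>2" by simp
  thus "R * norm (z - a) = norm (of_real (R\<^sup>2) - cnj a * z)"
    using R by (metis norm_ge_zero mult_nonneg_nonneg power2_eq_iff_nonneg)
qed

text \<open>
  Induction on the number of distinct zeros: a zero \<open>a\<close> of order \<open>n\<close> is removed by dividing by the
  \<open>n\<close>-th power of the Blaschke factor at \<open>a\<close> of the disc of radius \<open>R\<close>.
\<close>

lemma remove_zeros_in_disc:
  assumes "f holomorphic_on ball 0 S" "0 < R" "R < S" "\<And>z. norm z = R \<Longrightarrow> f z \<noteq> 0"
  obtains g where "g holomorphic_on ball 0 S" "\<And>z. z \<in> cball 0 R \<Longrightarrow> g z \<noteq> 0"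
    "\<And>z. z \<in> cball 0 R \<Longrightarrow> norm (f z) \<le> norm (g z)"
    "\<And>z. norm z = R \<Longrightarrow> norm (f z) = norm (g z)"
proof -
  have "\<exists>g. g holomorphic_on ball 0 S \<and> (\<forall>z\<in>cball 0 R. g z \<noteq> 0 \<and> norm (f z) \<le> norm (g z)) \<and>
            (\<forall>z. norm z = R \<longrightarrow> norm (f z) = norm (g z))"
    using assms(1,4)
  proof (induction "card {z \<in> cball 0 R. f z = 0}" arbitrary: f rule: less_induct)
    case less
    let ?D = "ball (0::complex) S"
    have D: "open ?D" "connected ?D" by auto
    have RS: "of_real R \<in> ?D" using assms by auto
    have f0: "\<exists>z\<in>?D. f z \<noteq> 0" using less.prems(2)[of "of_real R"] RS assms by auto
    have fin: "finite {z \<in> cball 0 R. f z = 0}"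
    proof (cases "f constant_on ?D")
      case True
      then obtain c where c: "\<And>z. z \<in> ?D \<Longrightarrow> f z = c" unfolding constant_on_def by blast
      hence "{z \<in> cball 0 R. f z = 0} = {}" using f0 assms(3) by fastforce
      thus ?thesis by (metis finite.emptyI)
    next
      case False
      thus ?thesis using assms(3) less.prems(1)
        by (intro holomorphic_compact_finite_zeros[OF _ D]) auto
    qed
    show ?case
    proof (cases "\<exists>a\<in>cball 0 R. f a = 0")
      case False
      thus ?thesis using less.prems(1) by (intro exI[of _ f]) auto
    next
      case True
      then obtain a where a: "a \<in> cball 0 R" "f a = 0" by blast
      have aR: "norm a < R" using a less.prems(2)[of a] by (auto simp: order_less_le)
      have aD: "a \<in> ?D" using aR assms by simp
      define n where "n = nat (zorder f a)"
      have n: "n > 0" "zorder f a = int n"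
        using zorder_exist_zero[OF less.prems(1) D aD f0] a(2) by (auto simp: n_def)
      have ord: "zorder (\<lambda>z. (z - a) ^ n) a = int n"
        by (rule zorder_eqI[of UNIV _ "\<lambda>_. 1"]) auto
      have hol: "(\<lambda>z. (z - a) ^ n) holomorphic_on ?D" by (intro holomorphic_intros)
      have nz: "\<exists>z\<in>?D. (z - a) ^ n \<noteq> 0"
      proof (rule bexI[OF _ RS])
        have "of_real R \<noteq> a" using aR assms(2) by auto
        thus "(of_real R - a) ^ n \<noteq> 0" by simp
      qed
      have ord_le: "zorder (\<lambda>z. (z - a) ^ n) w \<le> zorder f w" if "(w - a) ^ n = 0" for w
        using that ord n by simp
      obtain q where q: "q holomorphic_on ?D" "\<And>z. z \<in> ?D \<Longrightarrow> f z = (z - a) ^ n * q z"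
        using holomorphic_divides_if_zorder_le[OF D less.prems(1) hol f0 nz ord_le] by blast
      have q0: "\<exists>z\<in>?D. (z - a) ^ n * q z \<noteq> 0" "\<exists>z\<in>?D. q z \<noteq> 0" using f0 q(2) by auto
      have qa: "q a \<noteq> 0"
      proof -
        have "\<forall>\<^sub>F z in nhds a. z \<in> ?D"
          using aD by (intro eventually_nhds_in_open) auto
        hence "\<forall>\<^sub>F z in at a. f z = (z - a) ^ n * q z"
          unfolding eventually_at_filter by eventually_elim (use q(2) in auto)
        hence "zorder f a = zorder (\<lambda>z. (z - a) ^ n * q z) a" by (rule zorder_cong) auto
        also have "\<dots> = int n + zorder q a"
          using zorder_times_holomorphic[OF D aD hol q(1) q0(1)] ord by simp
        finally have "zorder q a = 0" using n by simp
        thus ?thesis using zorder_exist_zero[OF q(1) D aD q0(2)] by auto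
      qed
      define b where "b = (\<lambda>z. (of_real (R\<^sup>2) - cnj a * z) / of_real R)"
      define f1 where "f1 = (\<lambda>z. b z ^ n * q z)"
      have f1: "f1 holomorphic_on ?D"
        unfolding f1_def b_def using assms(2) by (intro holomorphic_intros q) auto
      have ble: "norm (z - a) \<le> norm (b z)" if "z \<in> cball 0 R" for z
        using norm_diff_le_reflected(1)[of a R z] that aR assms(2)
        by (simp add: b_def norm_divide field_simps)
      have beq: "norm (z - a) = norm (b z)" if "norm z = R" for z
        using norm_diff_le_reflected(2)[of a R z] that aR assms(2)
        by (simp add: b_def norm_divide field_simps)
      have b0: "b z \<noteq> 0" if "z \<in> cball 0 R" for z
      proof (cases "z = a")
        case True
        have "cnj a * a = of_real ((norm a)\<^sup>2)" by (simp only: complex_norm_square mult.commute)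
        moreover have "(norm a)\<^sup>2 < R\<^sup>2" using aR by (intro power_strict_mono) auto
        ultimately have "of_real (R\<^sup>2) - cnj a * a \<noteq> 0" by (metis of_real_eq_iff eq_iff_diff_eq_0 less_irrefl)
        thus ?thesis using assms(2) True by (simp add: b_def)
      qed (use ble[OF that] in auto)
      have sub: "cball 0 R \<subseteq> ?D" using assms(3) by auto
      have le: "norm (f z) \<le> norm (f1 z)" if "z \<in> cball 0 R" for z
      proof -
        have "f z = (z - a) ^ n * q z" using q(2) that sub by blast
        thus ?thesis using ble[OF that]
          by (auto simp: f1_def norm_mult norm_power intro!: mult_right_mono power_mono)
      qed
      have eq: "norm (f z) = norm (f1 z)" if "norm z = R" for z
        using beq[OF that] q(2)[of z] that assms(3)
        by (auto simp: f1_def norm_mult norm_power)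
      have "{z \<in> cball 0 R. f1 z = 0} \<subseteq> {z \<in> cball 0 R. f z = 0} - {a}"
        using b0 qa q(2) sub a by (auto simp: f1_def simp del: mem_ball mem_cball)
      hence "card {z \<in> cball 0 R. f1 z = 0} < card {z \<in> cball 0 R. f z = 0}"
        using a fin by (intro psubset_card_mono) auto
      moreover have "f1 z \<noteq> 0" if "norm z = R" for z
        using eq[OF that] less.prems(2)[OF that] by auto
      ultimately obtain g where "g holomorphic_on ?D"
        "\<forall>z\<in>cball 0 R. g z \<noteq> 0 \<and> norm (f1 z) \<le> norm (g z)"
        "\<forall>z. norm z = R \<longrightarrow> norm (f1 z) = norm (g z)"
        using less.hyps[OF _ f1] by blast
      with le eq show ?thesis by (intro exI[of _ g]) (auto intro: order_trans[OF le])
    qed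
  qed
  thus ?thesis using that by blast
qed

text \<open>
  The zero-free majorant of \<open>\<bar>f\<bar>\<close> has a logarithm on a neighbourhood of the closed disc, and with
  it a holomorphic \<open>p\<close>-th power, to which the Poisson bound applies.
\<close>

lemma norm_powr_le_poisson_integral:
  assumes f: "f holomorphic_on ball 0 S" "0 < R" "R < S" "\<And>z. norm z = R \<Longrightarrow> f z \<noteq> 0"
    and w: "norm w < R" and p: "0 < p"
  shows "2 * pi * norm (f w) powr p \<le>
     integral {0..2 * pi} (\<lambda>t. poisson_kernel w (of_real R * cis t) * norm (f (of_real R * cis t)) powr p)"
proof -
  obtain g where g: "g holomorphic_on ball 0 S" "\<And>z. z \<in> cball 0 R \<Longrightarrow> g z \<noteq> 0"
    "\<And>z. z \<in> cball 0 R \<Longrightarrow> norm (f z) \<le> norm (g z)"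
    "\<And>z. norm z = R \<Longrightarrow> norm (f z) = norm (g z)"
    using remove_zeros_in_disc[OF f] by blast
  define U where "U = {z \<in> ball 0 S. g z \<noteq> 0}"
  have "open (g -` (-{0}) \<inter> ball 0 S)"
    using holomorphic_on_imp_continuous_on[OF g(1)]
    by (intro continuous_on_open_vimage[THEN iffD1, rule_format]) auto
  moreover have "g -` (-{0}) \<inter> ball 0 S = U" by (auto simp: U_def)
  ultimately have "open U" "cball 0 R \<subseteq> U" using g(2) f(3) by (auto simp: U_def)
  then obtain e where e: "e > 0" "(\<Union>x\<in>cball 0 R. ball x e) \<subseteq> U"
    using compact_subset_open_imp_ball_epsilon_subset[of "cball 0 R" U] by auto
  \<comment> \<open>A point outside the disc of radius \<open>R\<close> is close to its radial projection to the circle.\<close>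
  have "ball 0 (R + e) \<subseteq> U"
  proof
    fix z :: complex assume "z \<in> ball 0 (R + e)"
    hence z: "norm z < R + e" by simp
    show "z \<in> U"
    proof (cases "norm z \<le> R")
      case True
      thus ?thesis using \<open>cball 0 R \<subseteq> U\<close> by auto
    next
      case False
      define x where "x = of_real (R / norm z) * z"
      have "z \<noteq> 0" using False f(2) by auto
      have scale: "\<bar>R / norm z - 1\<bar> * norm z = norm z - R"
        using False \<open>z \<noteq> 0\<close> f(2) by (simp add: abs_if field_simps)
      have "norm x = R" using \<open>z \<noteq> 0\<close> f(2) by (simp add: x_def norm_mult norm_divide)
      moreover have "norm (x - z) = norm (of_real (R / norm z - 1) * z)"
        by (simp add: x_def algebra_simps)
      hence "norm (x - z) = norm z - R"
        unfolding norm_mult norm_of_real scale .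
      ultimately have "z \<in> ball x e" "x \<in> cball 0 R" using z by (auto simp: dist_norm)
      thus ?thesis using e(2) by blast
    qed
  qed
  moreover have "U \<subseteq> ball 0 S" by (auto simp: U_def)
  ultimately have gU: "g holomorphic_on ball 0 (R + e)" "\<And>z. z \<in> ball 0 (R + e) \<Longrightarrow> g z \<noteq> 0"
    using holomorphic_on_subset[OF g(1), of "ball 0 (R + e)"]
    by (blast, auto simp: U_def simp del: mem_ball)
  obtain L where L: "L holomorphic_on ball 0 (R + e)" "\<And>z. z \<in> ball 0 (R + e) \<Longrightarrow> exp (L z) = g z"
    using holomorphic_logarithm_exists[of "ball 0 (R + e)" g 0] gU e(1) f(2) by auto
  define h where "h = (\<lambda>z. exp (of_real p * L z))"
  have h: "h holomorphic_on ball 0 (R + e)" unfolding h_def by (intro holomorphic_intros L)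
  have nh: "norm (h z) = norm (g z) powr p" if "z \<in> cball 0 R" for z
  proof -
    have "z \<in> ball 0 (R + e)" using that e(1) by auto
    hence "norm (g z) = exp (Re (L z))" using L(2)[of z] by (metis norm_exp_eq_Re)
    thus ?thesis by (simp add: h_def powr_def)
  qed
  have "norm (f w) powr p \<le> norm (h w)"
    using g(3)[of w] w p nh[of w] by (auto intro!: powr_mono2)
  hence "2 * pi * norm (f w) powr p \<le> 2 * pi * norm (h w)" by simp
  also have "\<dots> \<le> integral {0..2 * pi} (\<lambda>t. poisson_kernel w (of_real R * cis t) * norm (h (of_real R * cis t)))"
    using h e(1) w
    by (intro norm_le_poisson_integral)
       (auto intro!: holomorphic_on_imp_continuous_on intro: holomorphic_on_subset)
  also have "(\<lambda>t. poisson_kernel w (of_real R * cis t) * norm (h (of_real R * cis t))) =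
             (\<lambda>t. poisson_kernel w (of_real R * cis t) * norm (f (of_real R * cis t)) powr p)"
  proof
    fix t
    have "norm (of_real R * cis t) = R" using f(2) by (simp add: norm_mult)
    thus "poisson_kernel w (of_real R * cis t) * norm (h (of_real R * cis t)) =
          poisson_kernel w (of_real R * cis t) * norm (f (of_real R * cis t)) powr p"
      using nh[of "of_real R * cis t"] g(4)[of "of_real R * cis t"] by simp
  qed
  finally show ?thesis .
qed

section \<open>Littlewood subordination\<close>

definition circle_mean :: "real \<Rightarrow> (complex \<Rightarrow> complex) \<Rightarrow> real \<Rightarrow> real" where
  "circle_mean p f r =
     1 / (2 * pi) * integral {0..2 * pi} (\<lambda>t. norm (f (of_real r * cis t)) powr p)"

lemma hardy_space_iff:
  "f \<in> hardy_space p \<longleftrightarrow>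
     f holomorphic_on ball 0 1 \<and> (\<exists>K. \<forall>r. 0 < r \<longrightarrow> r < 1 \<longrightarrow> circle_mean p f r \<le> K)"
  unfolding hardy_space_def circle_mean_def bdd_above_def mem_Collect_eq ball_simps
  by (simp add: Ball_def imp_conjL)

lemma circle_in_disk [simp]:
  assumes "0 < r" "r < 1"
  shows "norm (of_real r * cis t) < 1"
  using assms by (simp add: norm_mult)

lemma continuous_on_circle_powr:
  assumes "f holomorphic_on ball 0 1" "0 < r" "r < 1" "0 < p"
  shows "continuous_on A (\<lambda>t. norm (f (of_real r * cis t)) powr p)"
  using assms
  by (intro continuous_on_powr' continuous_intros
        continuous_on_compose2[OF holomorphic_on_imp_continuous_on[OF assms(1)]]) auto

lemma circle_mean_mono:
  assumes "f holomorphic_on ball 0 1" "g holomorphic_on ball 0 1" "0 < r" "r < 1" "0 < p"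
    and "\<And>z. norm z = r \<Longrightarrow> norm (f z) \<le> norm (g z)"
  shows "circle_mean p f r \<le> circle_mean p g r"
  unfolding circle_mean_def using assms
  by (intro mult_left_mono integral_le integrable_continuous_interval continuous_on_circle_powr
        powr_mono2) (auto simp: norm_mult)

text \<open>Zeros in a smaller closed disc are finite in number, so most radii avoid them.\<close>

lemma circle_without_zeros:
  assumes f: "f holomorphic_on ball 0 1" "\<exists>z\<in>ball 0 1. f z \<noteq> 0" and "0 \<le> \<rho>" "\<rho> < 1"
  obtains R where "\<rho> < R" "R < 1" "\<And>z. norm z = R \<Longrightarrow> f z \<noteq> 0"
proof -
  define \<sigma> where "\<sigma> = (1 + \<rho>) / 2"
  have \<sigma>: "\<rho> < \<sigma>" "\<sigma> < 1" using assms(4) by (auto simp: \<sigma>_def)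
  have "finite {z \<in> cball 0 \<sigma>. f z = 0}"
  proof (cases "f constant_on ball 0 1")
    case True
    then obtain c where c: "\<And>z. z \<in> ball 0 1 \<Longrightarrow> f z = c" unfolding constant_on_def by blast
    hence "{z \<in> cball 0 \<sigma>. f z = 0} = {}" using f(2) \<sigma> by fastforce
    thus ?thesis by (metis finite.emptyI)
  next
    case False
    thus ?thesis using f(1) \<sigma> by (intro holomorphic_compact_finite_zeros[of f "ball 0 1"]) auto
  qed
  hence "finite (norm ` {z \<in> cball 0 \<sigma>. f z = 0})" by simp
  hence "\<not> {\<rho><..<\<sigma>} \<subseteq> norm ` {z \<in> cball 0 \<sigma>. f z = 0}"
    using infinite_Ioo[OF \<sigma>(1)] finite_subset by blast
  then obtain R where R: "\<rho> < R" "R < \<sigma>" "R \<notin> norm ` {z \<in> cball 0 \<sigma>. f z = 0}"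
    unfolding subset_iff greaterThanLessThan_iff by blast
  show ?thesis
  proof (rule that)
    show "\<rho> < R" "R < 1" using R \<sigma> by auto
    show "f z \<noteq> 0" if "norm z = R" for z using that R by auto
  qed
qed

lemma integral_poisson_kernel_comp:
  assumes \<phi>: "\<phi> holomorphic_on ball 0 1" and r: "0 < r" "r < 1" "norm \<zeta> = R"
    and \<phi>R: "\<And>z. z \<in> cball 0 r \<Longrightarrow> norm (\<phi> z) < R"
  shows "integral {0..2 * pi} (\<lambda>s. poisson_kernel (\<phi> (of_real r * cis s)) \<zeta>) =
         2 * pi * poisson_kernel (\<phi> 0) \<zeta>"
proof -
  define k where "k = (\<lambda>z. (\<zeta> + \<phi> z) / (\<zeta> - \<phi> z))"
  have ne: "\<zeta> \<noteq> \<phi> z" if "norm z \<le> r" for z using \<phi>R[of z] r that by auto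
  have "k holomorphic_on cball 0 r"
    unfolding k_def using ne r
    by (intro holomorphic_intros holomorphic_on_subset[OF \<phi>]) auto
  hence "((\<lambda>s. k (of_real r * cis s) * (of_real r * cis s / (of_real r * cis s - 0)))
            has_integral of_real (2 * pi) * k 0) {0..2 * pi}"
    using r by (intro Cauchy_integral_circle_angle)
      (auto intro: holomorphic_on_imp_continuous_on holomorphic_on_subset)
  hence "((\<lambda>s. k (of_real r * cis s)) has_integral of_real (2 * pi) * k 0) {0..2 * pi}"
    using r by simp
  hence "((\<lambda>s. Re (k (of_real r * cis s))) has_integral Re (of_real (2 * pi) * k 0)) {0..2 * pi}"
    by (rule has_integral_Re)
  moreover have "Re (of_real (2 * pi) * k 0) = 2 * pi * poisson_kernel (\<phi> 0) \<zeta>"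
    unfolding k_def poisson_kernel_eq_Re by (simp only: times_complex.sel Re_complex_of_real Im_complex_of_real)
  ultimately show ?thesis
    unfolding k_def poisson_kernel_eq_Re by (intro integral_unique) simp
qed

text \<open>
  The sub-Poisson inequality at the points of the image of the small circle, integrated over that
  circle. After the integrals are exchanged, the mean value property turns the inner one into the
  Poisson kernel at \<open>\<phi> 0\<close>, whose maximum on the circle of radius \<open>R\<close> is the constant.
\<close>

lemma circle_mean_comp_le:
  assumes f: "f holomorphic_on ball 0 1" and R: "R < 1" "\<And>z. norm z = R \<Longrightarrow> f z \<noteq> 0"
    and \<phi>: "\<phi> holomorphic_on ball 0 1" and r: "0 < r" "r < 1" and p: "0 < p"
    and \<phi>R: "\<And>z. z \<in> cball 0 r \<Longrightarrow> norm (\<phi> z) < R"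
  shows "circle_mean p (f \<circ> \<phi>) r \<le> (R + norm (\<phi> 0)) / (R - norm (\<phi> 0)) * circle_mean p f R"
proof -
  have \<phi>0: "norm (\<phi> 0) < R" using \<phi>R[of 0] r by simp
  hence R0: "0 < R" by (meson norm_ge_zero order_le_less_trans)
  define \<zeta> where "\<zeta> = (\<lambda>t. of_real R * cis t)"
  define w where "w = (\<lambda>s. \<phi> (of_real r * cis s))"
  define F where "F = (\<lambda>t. norm (f (\<zeta> t)) powr p)"
  define P where "P = (\<lambda>s t. poisson_kernel (w s) (\<zeta> t) * F t)"
  define C where "C = (R + norm (\<phi> 0)) / (R - norm (\<phi> 0))"
  have n\<zeta>: "norm (\<zeta> t) = R" for t using R0 by (simp add: \<zeta>_def norm_mult)
  have wR: "norm (w s) < R" for s using r \<phi>R by (simp add: w_def norm_mult)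
  have contF: "continuous_on A F" for A
    unfolding F_def \<zeta>_def using f R0 R(1) p by (intro continuous_on_circle_powr) auto
  have contw: "continuous_on A w" for A
    unfolding w_def using r
    by (intro continuous_on_compose2[OF holomorphic_on_imp_continuous_on[OF \<phi>]] continuous_intros) auto
  have ne: "\<zeta> t \<noteq> w s" for s t using n\<zeta>[of t] wR[of s] by auto
  have contP: "continuous_on (cbox (0, 0) (2 * pi, 2 * pi)) (\<lambda>(s, t). P s t)"
    unfolding P_def poisson_kernel_def case_prod_unfold
    using ne
    by (intro continuous_intros continuous_on_compose2[OF contw[of UNIV]]
          continuous_on_compose2[OF contF[of UNIV]]) (auto simp: \<zeta>_def intro!: continuous_intros)
  have contJ: "continuous_on {0..2 * pi} (\<lambda>s. integral {0..2 * pi} (P s))"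
    using integral_continuous_on_param[of "{0..2 * pi}" 0 "2 * pi" P] contP
    by (simp add: cbox_Pair_eq)
  have sub: "2 * pi * norm (f (w s)) powr p \<le> integral {0..2 * pi} (P s)" for s
    unfolding P_def F_def \<zeta>_def
    by (rule norm_powr_le_poisson_integral[OF f R0 R wR p])
  have "continuous_on {0..2 * pi} (\<lambda>s. f (w s))"
    using less_trans[OF wR R(1)]
    by (intro continuous_on_compose2[OF holomorphic_on_imp_continuous_on[OF f] contw]) auto
  hence contfw: "continuous_on {0..2 * pi} (\<lambda>s. 2 * pi * norm (f (w s)) powr p)"
    using p by (intro continuous_intros continuous_on_powr') auto
  have "integral {0..2 * pi} (\<lambda>s. 2 * pi * norm (f (w s)) powr p)
          \<le> integral {0..2 * pi} (\<lambda>s. integral {0..2 * pi} (P s))"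
    by (intro integral_le integrable_continuous_interval contJ sub contfw)
  also have "\<dots> = integral {0..2 * pi} (\<lambda>t. integral {0..2 * pi} (\<lambda>s. P s t))"
    using integral_swap_continuous[OF contP] by simp
  also have "\<dots> = integral {0..2 * pi} (\<lambda>t. 2 * pi * poisson_kernel (\<phi> 0) (\<zeta> t) * F t)"
    unfolding P_def w_def
    using integral_poisson_kernel_comp[OF \<phi> r n\<zeta> \<phi>R] by simp
  also have "\<dots> \<le> integral {0..2 * pi} (\<lambda>t. 2 * pi * C * F t)"
  proof (intro integral_le integrable_continuous_interval continuous_intros contF)
    show "continuous_on {0..2 * pi} (\<lambda>t. poisson_kernel (\<phi> 0) (\<zeta> t))"
    proof -
      have "\<zeta> t \<noteq> \<phi> 0" for t using n\<zeta>[of t] \<phi>0 by auto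
      thus ?thesis
        unfolding poisson_kernel_def by (auto simp: \<zeta>_def intro!: continuous_intros)
    qed
    show "2 * pi * poisson_kernel (\<phi> 0) (\<zeta> t) * F t \<le> 2 * pi * C * F t" for t
      using poisson_kernel_le[of "\<phi> 0" "\<zeta> t"] \<phi>0 unfolding n\<zeta> C_def[symmetric]
      by (intro mult_right_mono mult_left_mono) (auto simp: F_def)
  qed
  finally have "integral {0..2 * pi} (\<lambda>s. norm (f (w s)) powr p) \<le> C * integral {0..2 * pi} F"
    by simp
  hence "1 / (2 * pi) * integral {0..2 * pi} (\<lambda>s. norm (f (w s)) powr p) \<le>
           1 / (2 * pi) * (C * integral {0..2 * pi} F)"
    by (intro mult_left_mono) auto
  also have "\<dots> = C * (1 / (2 * pi) * integral {0..2 * pi} F)" by (simp only: mult.left_commute)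
  finally show ?thesis
    unfolding circle_mean_def C_def w_def F_def \<zeta>_def o_def .
qed

text \<open>
  The radius \<open>R\<close> can be taken as close to 1 as desired; this is what allows the boundary behaviour
  of \<open>f\<close> to control its means inside, and keeps the constant bounded in Littlewood's theorem.
\<close>

lemma circle_mean_subordination:
  assumes f: "f holomorphic_on ball 0 1" and \<phi>: "\<phi> holomorphic_on ball 0 1" "\<phi> ` ball 0 1 \<subseteq> ball 0 1"
    and r: "0 < r" "r < 1" and p: "0 < p" and "0 \<le> \<rho>" "\<rho> < 1"
  obtains R where "\<rho> < R" "R < 1" "norm (\<phi> 0) < R"
    "circle_mean p (f \<circ> \<phi>) r \<le> (R + norm (\<phi> 0)) / (R - norm (\<phi> 0)) * circle_mean p f R"
proof -
  have "continuous_on (cball 0 r) (\<lambda>z. norm (\<phi> z))"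
    using r by (intro continuous_on_norm holomorphic_on_imp_continuous_on
        holomorphic_on_subset[OF \<phi>(1)]) auto
  then obtain z0 where z0: "z0 \<in> cball 0 r" "\<And>z. z \<in> cball 0 r \<Longrightarrow> norm (\<phi> z) \<le> norm (\<phi> z0)"
    using continuous_attains_sup[of "cball 0 r" "\<lambda>z. norm (\<phi> z)"] r by auto
  define \<rho>' where "\<rho>' = max \<rho> (norm (\<phi> z0))"
  have "norm (\<phi> z0) < 1" using z0(1) r \<phi>(2) by (force simp: image_subset_iff)
  hence \<rho>': "0 \<le> \<rho>'" "\<rho>' < 1" using assms(7,8) by (auto simp: \<rho>'_def)
  have bound: "norm (\<phi> z) \<le> \<rho>'" if "z \<in> cball 0 r" for z
    using z0(2)[OF that] by (simp add: \<rho>'_def)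
  show ?thesis
  proof (cases "\<exists>z\<in>ball 0 1. f z \<noteq> 0")
    case True
    obtain R where R: "\<rho>' < R" "R < 1" "\<And>z. norm z = R \<Longrightarrow> f z \<noteq> 0"
      using circle_without_zeros[OF f True \<rho>'] by blast
    show ?thesis
    proof (rule that)
      show "\<rho> < R" "R < 1" using R by (auto simp: \<rho>'_def)
      show "norm (\<phi> 0) < R" using bound[of 0] r R by simp
      show "circle_mean p (f \<circ> \<phi>) r \<le> (R + norm (\<phi> 0)) / (R - norm (\<phi> 0)) * circle_mean p f R"
        using bound R(1) by (intro circle_mean_comp_le f R \<phi> r p) (auto intro: le_less_trans)
    qed
  next
    case False
    \<comment> \<open>For \<open>f = 0\<close> both means vanish, and every admissible radius will do.\<close>
    define R where "R = (\<rho>' + 1) / 2"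
    have R: "\<rho>' < R" "R < 1" using \<rho>' by (auto simp: R_def)
    have "0 < R" using R \<rho>' by simp
    have "f (\<phi> (of_real r * cis t)) = 0" "f (of_real R * cis t) = 0" for t
      using False \<phi>(2) circle_in_disk[OF r, of t] circle_in_disk[OF \<open>0 < R\<close> R(2), of t] 
      by (auto simp: image_subset_iff)
    hence "circle_mean p (f \<circ> \<phi>) r = 0" "circle_mean p f R = 0"
      using p by (auto simp: circle_mean_def)
    thus ?thesis using that[of R] R bound[of 0] r by (auto simp: \<rho>'_def)
  qed
qed

theorem Littlewood_subordination:
  assumes f: "f \<in> hardy_space p" and p: "0 < p"
    and \<phi>: "\<phi> holomorphic_on ball 0 1" "\<phi> ` ball 0 1 \<subseteq> ball 0 1"
  shows "f \<circ> \<phi> \<in> hardy_space p"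
proof -
  obtain K where hol: "f holomorphic_on ball 0 1"
    and K: "\<And>r. 0 < r \<Longrightarrow> r < 1 \<Longrightarrow> circle_mean p f r \<le> K"
    using f unfolding hardy_space_iff by blast
  define a where "a = norm (\<phi> 0)"
  have a: "0 \<le> a" "a < 1" using \<phi>(2) by (auto simp: a_def image_subset_iff)
  have "circle_mean p (f \<circ> \<phi>) r \<le> 4 / (1 - a) * K" if r: "0 < r" "r < 1" for r
  proof -
    \<comment> \<open>Beyond the radius \<open>(1 + a) / 2\<close> the subordination constant is at most \<open>4 / (1 - a)\<close>,
      uniformly in \<open>r\<close>.\<close>
    have "0 \<le> (1 + a) / 2" "(1 + a) / 2 < 1" using a by auto
    then obtain R where R: "(1 + a) / 2 < R" "R < 1"
      "circle_mean p (f \<circ> \<phi>) r \<le> (R + a) / (R - a) * circle_mean p f R"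
      using circle_mean_subordination[OF hol \<phi> r p] unfolding a_def by blast
    have "0 \<le> circle_mean p f R"
      unfolding circle_mean_def using hol R a p
      by (intro mult_nonneg_nonneg integral_nonneg integrable_continuous_interval
            continuous_on_circle_powr) auto
    moreover have "circle_mean p f R \<le> K" using K R a by auto
    moreover have "(R + a) / (R - a) \<le> 2 / ((1 - a) / 2)"
      using R a by (intro frac_le) (auto simp: field_simps)
    hence "(R + a) / (R - a) \<le> 4 / (1 - a)" by simp
    ultimately have "(R + a) / (R - a) * circle_mean p f R \<le> 4 / (1 - a) * K"
      using a by (intro mult_mono) auto
    with R(3) show ?thesis by linarith
  qed
  moreover have "(f \<circ> \<phi>) holomorphic_on ball 0 1"
    by (rule holomorphic_on_compose_gen[OF \<phi>(1) hol \<phi>(2)])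
  ultimately show ?thesis unfolding hardy_space_iff by blast
qed

section \<open>Blaschke products\<close>

lemma one_minus_cnj_mult_nonzero:
  assumes "norm a < 1" "norm z \<le> 1"
  shows "1 - cnj a * z \<noteq> 0"
proof
  assume "1 - cnj a * z = 0"
  hence "norm (cnj a * z) = 1" by simp
  moreover have "norm a * norm z \<le> norm a * 1" using assms by (intro mult_left_mono) auto
  ultimately show False using assms by (simp add: norm_mult)
qed

lemma blaschke_factor_holomorphic:
  "norm a < 1 \<Longrightarrow> blaschke_factor a holomorphic_on cball 0 1"
  unfolding blaschke_factor_def[abs_def] using one_minus_cnj_mult_nonzero[of a]
  by (cases "a = 0") (auto intro!: holomorphic_intros)

lemma norm_blaschke_factor:
  assumes "a \<noteq> 0"
  shows "norm (blaschke_factor a z) = norm (z - a) / norm (1 - cnj a * z)"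
  using assms by (simp add: blaschke_factor_def norm_mult norm_divide norm_minus_commute)

lemma norm_blaschke_factor_le_1:
  assumes "a \<noteq> 0" "norm a < 1" "norm z \<le> 1"
  shows "norm (blaschke_factor a z) \<le> 1"
  using norm_diff_le_reflected(1)[of a 1 z] one_minus_cnj_mult_nonzero[of a z] assms
  by (simp add: norm_blaschke_factor)

lemma norm_blaschke_factor_eq_1:
  assumes "a \<noteq> 0" "norm a < 1" "norm z = 1"
  shows "norm (blaschke_factor a z) = 1"
  using norm_diff_le_reflected(2)[of a 1 z] one_minus_cnj_mult_nonzero[of a z] assms
  by (simp add: norm_blaschke_factor)

text \<open>
  This is what makes the product converge: the sum of the deviations from 1 is dominated, uniformly
  on compact sets, by the sum of the \<open>1 - \<bar>a\<^sub>i\<bar>\<close>.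
\<close>

lemma norm_blaschke_factor_diff_1_le:
  assumes "a \<noteq> 0" "norm a < 1" "norm z < 1"
  shows "norm (blaschke_factor a z - 1) \<le> 2 / (1 - norm z) * (1 - norm a)"
proof -
  define \<alpha> where "\<alpha> = complex_of_real (norm a)"
  have nz: "1 - cnj a * z \<noteq> 0" using one_minus_cnj_mult_nonzero[of a z] assms by simp
  have sq: "a * cnj a = \<alpha> * \<alpha>"
    unfolding \<alpha>_def using complex_norm_square[of a] by (simp add: power2_eq_square)
  have "blaschke_factor a z = \<alpha> * (a - z) / (a * (1 - cnj a * z))"
    by (simp add: blaschke_factor_def \<alpha>_def)
  hence "blaschke_factor a z - 1 = (\<alpha> * (a - z) - a * (1 - cnj a * z)) / (a * (1 - cnj a * z))"
    using nz assms(1) by (simp only: diff_divide_distrib) simp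
  also have "\<alpha> * (a - z) - a * (1 - cnj a * z) = \<alpha> * (a - z) - a + (a * cnj a) * z"
    by (simp add: algebra_simps)
  also have "\<dots> = (\<alpha> - 1) * (a + \<alpha> * z)"
    unfolding sq by (simp add: algebra_simps)
  finally have "norm (blaschke_factor a z - 1) =
      norm (\<alpha> - 1) * norm (a + \<alpha> * z) / (norm a * norm (1 - cnj a * z))"
    by (simp add: norm_mult norm_divide)
  also have "norm (\<alpha> - 1) = 1 - norm a"
  proof -
    have "\<alpha> - 1 = of_real (norm a - 1)" by (simp add: \<alpha>_def)
    thus ?thesis using assms(2) by (metis abs_minus_commute abs_of_nonneg diff_ge_0_iff_ge less_imp_le norm_of_real)
  qed
  also have "(1 - norm a) * norm (a + \<alpha> * z) / (norm a * norm (1 - cnj a * z))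
      \<le> (1 - norm a) * (norm a * 2) / (norm a * (1 - norm z))"
  proof (intro frac_le mult_left_mono mult_pos_pos mult_nonneg_nonneg)
    have "norm (a + \<alpha> * z) \<le> norm a + norm a * norm z"
      using norm_triangle_ineq[of a "\<alpha> * z"] by (simp add: \<alpha>_def norm_mult)
    also have "\<dots> \<le> norm a + norm a * 1" using assms by (intro add_left_mono mult_left_mono) auto
    finally show "norm (a + \<alpha> * z) \<le> norm a * 2" by simp
    have "norm a * norm z \<le> 1 * norm z" using assms by (intro mult_right_mono) auto
    moreover have "1 - norm a * norm z \<le> norm (1 - cnj a * z)"
      using norm_triangle_ineq2[of 1 "cnj a * z"] by (simp add: norm_mult)
    ultimately show "1 - norm z \<le> norm (1 - cnj a * z)" by simp
  qed (use assms in auto)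
  also have "\<dots> = 2 / (1 - norm z) * (1 - norm a)" using assms by (simp add: field_simps)
  finally show ?thesis .
qed

text \<open>
  By compactness, the points where \<open>\<bar>P\<bar> \<le> \<epsilon>\<close> stay away from the unit circle.
\<close>

lemma norm_near_1_near_circle:
  fixes P :: "complex \<Rightarrow> complex"
  assumes P: "continuous_on (cball 0 1) P" "\<And>z. norm z = 1 \<Longrightarrow> norm (P z) = 1" and "\<epsilon> < 1"
  shows "\<exists>\<rho>. 0 \<le> \<rho> \<and> \<rho> < 1 \<and> (\<forall>z. \<rho> < norm z \<longrightarrow> norm z < 1 \<longrightarrow> \<epsilon> \<le> norm (P z))"
proof -
  define K where "K = {z \<in> cball 0 1. norm (P z) \<le> \<epsilon>}"
  show ?thesis
  proof (cases "K = {}")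
    case True
    hence "\<epsilon> < norm (P z)" if "norm z < 1" for z
      using that unfolding K_def by (metis (mono_tags, lifting) empty_Collect_eq less_imp_le mem_cball_0 not_le)
    thus ?thesis by (intro exI[of _ 0]) (auto intro: less_imp_le)
  next
    case False
    have "closedin (top_of_set (cball 0 1)) (cball 0 1 \<inter> (\<lambda>z. norm (P z)) -` {..\<epsilon>})"
      by (intro continuous_closedin_preimage continuous_on_norm P) auto
    moreover have "cball 0 1 \<inter> (\<lambda>z. norm (P z)) -` {..\<epsilon>} = K" by (auto simp: K_def)
    ultimately have "compact K"
      using closedin_compact[of "cball 0 (1::real)" K] by (metis compact_cball closedin_compact)
    then obtain z0 where z0: "z0 \<in> K" "\<And>z. z \<in> K \<Longrightarrow> norm z \<le> norm z0"
      using continuous_attains_sup[of K norm] False by (auto intro: continuous_on_norm_id)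
    have "norm z0 \<noteq> 1" using z0(1) P(2)[of z0] assms(3) by (auto simp: K_def)
    hence "norm z0 < 1" using z0(1) by (auto simp: K_def)
    moreover have "\<epsilon> \<le> norm (P z)" if "norm z0 < norm z" "norm z < 1" for z
      using z0(2)[of z] that by (fastforce simp: K_def)
    ultimately show ?thesis by (intro exI[of _ "norm z0"]) auto
  qed
qed

text \<open>
  The factors of index below \<open>n\<close> go into \<open>P n\<close>, together with the constant and the power of \<open>z\<close>; the
  others form the tail \<open>T n\<close>. Working with tails, rather than with quotients \<open>B / P n\<close>, avoids any
  exception at the zeros of \<open>B\<close>.
\<close>

lemma blaschke_product_tails:
  assumes "blaschke_product B"
  obtains P T :: "nat \<Rightarrow> complex \<Rightarrow> complex" where
    "\<And>n. continuous_on (cball 0 1) (P n)" "\<And>n. P n holomorphic_on ball 0 1"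
    "\<And>n z. norm z \<le> 1 \<Longrightarrow> norm (P n z) \<le> 1" "\<And>n z. norm z = 1 \<Longrightarrow> norm (P n z) = 1"
    "\<And>n. T n holomorphic_on ball 0 1" "\<And>n z. norm z < 1 \<Longrightarrow> norm (T n z) \<le> 1"
    "\<And>n z. norm z < 1 \<Longrightarrow> B z = P n z * T n z"
    "\<And>z. norm z < 1 \<Longrightarrow> (\<lambda>n. T n z) \<longlonglongrightarrow> 1"
    "\<exists>z\<in>ball 0 1. B z \<noteq> 0"
proof -
  obtain \<gamma> m I a where \<gamma>: "norm \<gamma> = 1" and a: "\<And>i. i \<in> I \<Longrightarrow> a i \<in> ball 0 1 - {0}"
    and sumI: "(\<lambda>i. 1 - norm (a i)) summable_on I"
    and Beq: "\<And>z. z \<in> ball 0 1 \<Longrightarrow>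
        B z = \<gamma> * z ^ m * prodinf (\<lambda>i. if i \<in> I then blaschke_factor (a i) z else 1)"
    using assms unfolding blaschke_product_def by blast
  define A where "A = (\<lambda>i z. if i \<in> I then blaschke_factor (a i) z else 1)"
  define s where "s = (\<lambda>i. if i \<in> I then 1 - norm (a i) else 0)"
  define P where "P = (\<lambda>n z. \<gamma> * z ^ m * (\<Prod>i<n. A i z))"
  define T where "T = (\<lambda>n z. prodinf (\<lambda>i. A (i + n) z))"
  have s: "summable s"
  proof -
    have "(\<lambda>i. 1 - norm (a i)) summable_on I \<longleftrightarrow> s summable_on UNIV"
      by (rule summable_on_cong_neutral) (auto simp: s_def)
    hence "s summable_on UNIV" using sumI by simp
    thus ?thesis by (rule summable_on_imp_summable)
  qed
  have s0: "s i \<ge> 0" for i using a[of i] by (auto simp: s_def)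
  have Ahol: "A i holomorphic_on cball 0 1" for i
    using a[of i] blaschke_factor_holomorphic[of "a i"] by (cases "i \<in> I") (auto simp: A_def)
  have A1: "norm (A i z) \<le> 1" if "norm z \<le> 1" for i z
    using norm_blaschke_factor_le_1[of "a i" z] a[of i] that by (auto simp: A_def)
  have A2: "norm (A i z) = 1" if "norm z = 1" for i z
    using norm_blaschke_factor_eq_1[of "a i" z] a[of i] that by (auto simp: A_def)
  have Abound: "norm (A i z - 1) \<le> 2 / (1 - norm z) * s i" if "norm z < 1" for i z
    using norm_blaschke_factor_diff_1_le[of "a i" z] a[of i] that by (auto simp: A_def s_def)
  have sn: "summable (\<lambda>i. c * s (i + n))" for c n
    using s by (intro summable_mult summable_ignore_initial_segment)
  have conv: "convergent_prod (\<lambda>i. A (i + n) z)" if z: "norm z < 1" for n z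
  proof (rule abs_convergent_prod_imp_convergent_prod, rule summable_imp_abs_convergent_prod)
    show "summable (\<lambda>i. norm (A (i + n) z - 1))"
      using Abound[OF z] by (intro summable_comparison_test'[OF sn[of "2 / (1 - norm z)" n]]) auto
  qed
  have lim: "(\<lambda>N. \<Prod>i<N. A (i + n) z) \<longlonglongrightarrow> T n z" if "norm z < 1" for n z
    using convergent_prod_LIMSEQ[OF conv[OF that, of n]]
    by (simp add: T_def LIMSEQ_lessThan_iff_atMost)
  \<comment> \<open>The partial products converge uniformly on closed discs, by the M-test for the deviations of
    the factors from 1.\<close>
  have Thol: "T n holomorphic_on ball 0 1" for n
  proof (rule holomorphic_uniform_sequence)
    show "(\<lambda>z. \<Prod>i<N. A (i + n) z) holomorphic_on ball 0 1" for N
      by (intro holomorphic_intros holomorphic_on_subset[OF Ahol]) auto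
    fix x :: complex assume "x \<in> ball 0 1"
    then obtain d where d: "d > 0" "cball x d \<subseteq> ball 0 1"
      using open_contains_cball by blast
    have "\<exists>r<1. \<forall>z\<in>cball x d. norm z \<le> r"
    proof -
      obtain z0 where "z0 \<in> cball x d" "\<forall>z\<in>cball x d. norm z \<le> norm z0"
        using continuous_attains_sup[of "cball x d" norm, OF _ _ continuous_on_norm_id] d(1)
        by (metis cball_eq_empty compact_cball not_le less_asym)
      thus ?thesis using d(2) by (intro exI[of _ "norm z0"]) auto
    qed
    then obtain r where r: "r < 1" "\<And>z. z \<in> cball x d \<Longrightarrow> norm z \<le> r" by blast
    have "uniformly_convergent_on (cball x d) (\<lambda>N z. \<Sum>i<N. norm (A (i + n) z - 1))"
    proof (rule Weierstrass_m_test'[OF _ sn[of "2 / (1 - r)" n]])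
      fix i z assume z: "z \<in> cball x d"
      have "norm (A (i + n) z - 1) \<le> 2 / (1 - norm z) * s (i + n)"
        using Abound[of z] r(2)[OF z] r(1) by simp
      also have "\<dots> \<le> 2 / (1 - r) * s (i + n)"
        using r(2)[OF z] r(1) s0 by (intro mult_right_mono frac_le) auto
      finally show "norm (norm (A (i + n) z - 1)) \<le> 2 / (1 - r) * s (i + n)" by simp
    qed
    moreover have "continuous_on (cball x d) (A (i + n))" for i
      using d(2) by (intro continuous_on_subset[OF holomorphic_on_imp_continuous_on[OF Ahol]]) auto
    ultimately have "uniformly_convergent_on (cball x d) (\<lambda>N z. \<Prod>i<N. A (i + n) z)"
      by (intro uniformly_convergent_on_prod') auto
    hence "uniform_limit (cball x d) (\<lambda>N z. \<Prod>i<N. A (i + n) z)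
             (\<lambda>z. lim (\<lambda>N. \<Prod>i<N. A (i + n) z)) sequentially"
      by (simp add: uniformly_convergent_uniform_limit_iff)
    also have "?this \<longleftrightarrow> uniform_limit (cball x d) (\<lambda>N z. \<Prod>i<N. A (i + n) z) (T n) sequentially"
      using r by (intro uniform_limit_cong') (auto intro!: limI lim le_less_trans[OF r(2)])
    finally show "\<exists>d>0. cball x d \<subseteq> ball 0 1 \<and>
        uniform_limit (cball x d) (\<lambda>N z. \<Prod>i<N. A (i + n) z) (T n) sequentially"
      using d by blast
  qed auto
  have T1: "norm (T n z) \<le> 1" if z: "norm z < 1" for n z
  proof (rule tendsto_upperbound[OF tendsto_norm[OF lim[OF z]]])
    show "\<forall>\<^sub>F N in sequentially. norm (\<Prod>i<N. A (i + n) z) \<le> 1"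
      using A1 z by (auto simp: prod_norm[symmetric] intro!: always_eventually prod_le_1)
  qed auto
  have Bsplit: "B z = P n z * T n z" if z: "norm z < 1" for n z
  proof -
    have "(\<Prod>i<N + n. A i z) = (\<Prod>i<n. A i z) * (\<Prod>i<N. A (i + n) z)" for N
      by (induction N) (auto simp: mult_ac)
    moreover have "(\<lambda>N. (\<Prod>i<n. A i z) * (\<Prod>i<N. A (i + n) z)) \<longlonglongrightarrow> (\<Prod>i<n. A i z) * T n z"
      by (intro tendsto_intros lim z)
    moreover have "(\<lambda>N. \<Prod>i<N + n. A i z) \<longlonglongrightarrow> T 0 z"
      using lim[OF z, of 0] by (intro LIMSEQ_ignore_initial_segment) simp
    ultimately have "T 0 z = (\<Prod>i<n. A i z) * T n z"
      using LIMSEQ_unique by auto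
    moreover have "B z = \<gamma> * z ^ m * T 0 z" using Beq[of z] z by (simp add: T_def A_def cong: if_cong)
    ultimately show ?thesis by (simp add: P_def)
  qed
  have T_lim: "(\<lambda>n. T n z) \<longlonglongrightarrow> 1" if z: "norm z < 1" for z
  proof -
    define c where "c = 2 / (1 - norm z)"
    have c: "c \<ge> 0" using z by (simp add: c_def)
    \<comment> \<open>The exponent is a multiple of the remainder of the convergent series of the \<open>1 - \<bar>a\<^sub>i\<bar>\<close>.\<close>
    have bound: "norm (T n z - 1) \<le> exp (c * (suminf s - (\<Sum>i<n. s i))) - 1" for n
    proof (rule tendsto_upperbound[OF tendsto_norm[OF tendsto_diff[OF lim[OF z] tendsto_const]]])
      have "norm ((\<Prod>i<N. A (i + n) z) - 1) \<le> exp (c * (suminf s - (\<Sum>i<n. s i))) - 1" for N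
      proof -
        have "norm ((\<Prod>i<N. 1 + (A (i + n) z - 1)) - 1) \<le> (\<Prod>i<N. 1 + norm (A (i + n) z - 1)) - 1"
          by (rule norm_prod_minus1_le_prod_minus1)
        also have "\<dots> \<le> exp (\<Sum>i<N. norm (A (i + n) z - 1)) - 1"
          by (intro diff_right_mono prod_le_exp_sum) auto
        also have "(\<Sum>i<N. norm (A (i + n) z - 1)) \<le> (\<Sum>i<N. c * s (i + n))"
          using Abound[OF z] by (intro sum_mono) (auto simp: c_def)
        also have "\<dots> \<le> (\<Sum>i. c * s (i + n))"
          using s0 c sn by (intro sum_le_suminf) auto
        also have "\<dots> = c * (\<Sum>i. s (i + n))"
          using s by (intro suminf_mult summable_ignore_initial_segment)
        also have "(\<Sum>i. s (i + n)) = suminf s - (\<Sum>i<n. s i)"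
          by (rule suminf_minus_initial_segment[OF s])
        finally show ?thesis by simp
      qed
      thus "\<forall>\<^sub>F N in sequentially. norm ((\<Prod>i<N. A (i + n) z) - 1) \<le> exp (c * (suminf s - (\<Sum>i<n. s i))) - 1"
        by (intro always_eventually) blast
    qed auto
    have "(\<lambda>n. exp (c * (suminf s - (\<Sum>i<n. s i))) - 1) \<longlonglongrightarrow> exp (c * (suminf s - suminf s)) - 1"
      by (intro tendsto_intros summable_LIMSEQ s)
    hence "(\<lambda>n. exp (c * (suminf s - (\<Sum>i<n. s i))) - 1) \<longlonglongrightarrow> 0" by simp
    hence "(\<lambda>n. T n z - 1) \<longlonglongrightarrow> 0"
      by (rule Lim_null_comparison[rotated]) (simp add: bound)
    thus ?thesis by (simp add: LIM_zero_iff)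
  qed
  have nonzero: "\<exists>z\<in>ball 0 1. B z \<noteq> 0"
  proof -
    have "countable (insert 0 (range a))" by simp
    \<comment> \<open>A convergent product of nonzero factors is nonzero, so any point off the countably many
      zeros will do.\<close>
    hence "\<not> ball 0 1 \<subseteq> insert 0 (range a)"
      using uncountable_ball[of 1 "0::complex"] countable_subset by (metis zero_less_one)
    then obtain z where "z \<in> ball 0 1" "z \<notin> insert 0 (range a)" by blast
    hence z: "norm z < 1" "z \<noteq> 0" "\<And>i. z \<noteq> a i" by auto
    have "A i z \<noteq> 0" for i
      using a[of i] z one_minus_cnj_mult_nonzero[of "a i" z] by (auto simp: A_def blaschke_factor_def)
    hence "T 0 z \<noteq> 0"
      using prodinf_nonzero[OF conv[OF z(1), of 0]] by (simp add: T_def)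
    hence "B z \<noteq> 0" using Bsplit[OF z(1), of 0] z \<gamma> by (auto simp: P_def)
    thus ?thesis using z by auto
  qed
  have Phol: "P n holomorphic_on cball 0 1" for n
    unfolding P_def by (intro holomorphic_intros Ahol)
  show ?thesis
  proof (rule that[of P T])
    show "norm (P n z) \<le> 1" if "norm z \<le> 1" for n z
      using that A1 \<gamma> by (auto simp: P_def norm_mult norm_power prod_norm[symmetric]
          intro!: mult_le_one power_le_one prod_nonneg prod_le_1)
    show "norm (P n z) = 1" if "norm z = 1" for n z
      using that A2 \<gamma> by (simp add: P_def norm_mult norm_power prod_norm[symmetric])
    show "P n holomorphic_on ball 0 1" for n by (rule holomorphic_on_subset[OF Phol]) auto
  qed (fact holomorphic_on_imp_continuous_on[OF Phol] Thol T1 Bsplit T_lim nonzero)+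
qed

section \<open>Division by Blaschke products in Hardy spaces\<close>

lemma circle_mean_divide:
  assumes "0 < \<epsilon>"
  shows "circle_mean p (\<lambda>z. f z / of_real \<epsilon>) r = circle_mean p f r / \<epsilon> powr p"
  using assms by (simp add: circle_mean_def norm_divide powr_divide)

text \<open>
  Subordination for the identity, where the constant is 1. Its radii avoid the moduli of the zeros
  of \<open>f\<close>, hence the existential form.
\<close>

lemma circle_mean_increasing:
  assumes f: "f holomorphic_on ball 0 1" and "0 < r" "r < 1" "0 < p" "0 \<le> \<rho>" "\<rho> < 1"
  shows "\<exists>R. \<rho> < R \<and> R < 1 \<and> circle_mean p f r \<le> circle_mean p f R"
proof -
  have "(\<lambda>z. z) holomorphic_on ball (0::complex) 1" by (intro holomorphic_intros)
  moreover have "(\<lambda>z. z) ` ball (0::complex) 1 \<subseteq> ball 0 1" by simp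
  ultimately obtain R where "\<rho> < R" "R < 1" "norm (0::complex) < R"
    "circle_mean p (f \<circ> (\<lambda>z. z)) r \<le> (R + norm (0::complex)) / (R - norm (0::complex)) * circle_mean p f R"
    using circle_mean_subordination[OF f _ _ assms(2-6)] by metis
  thus ?thesis by (intro exI[of _ R]) (simp add: o_def)
qed

text \<open>
  The finite product \<open>P n\<close> has modulus at least \<open>\<epsilon>\<close> near the unit circle, for any \<open>\<epsilon> < 1\<close>. This
  bounds the means of \<open>T n G\<close> by those of \<open>B G\<close>, first up to a power of \<open>\<epsilon>\<close>, then exactly as \<open>\<epsilon>\<close>
  tends to 1. The bound does not depend on \<open>n\<close>, and survives the limit \<open>T n \<rightarrow> 1\<close>.
\<close>

theorem Riesz_division:
  assumes B: "blaschke_product B" and G: "G holomorphic_on ball 0 1" and p: "0 < p"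
    and BG: "(\<lambda>z. B z * G z) \<in> hardy_space p"
  shows "G \<in> hardy_space p"
proof -
  obtain P T :: "nat \<Rightarrow> complex \<Rightarrow> complex" where
    P: "\<And>n. continuous_on (cball 0 1) (P n)" "\<And>n z. norm z = 1 \<Longrightarrow> norm (P n z) = 1"
    and T: "\<And>n. T n holomorphic_on ball 0 1" "\<And>n z. norm z < 1 \<Longrightarrow> norm (T n z) \<le> 1"
    and PT: "\<And>n z. norm z < 1 \<Longrightarrow> B z = P n z * T n z"
    and T_lim: "\<And>z. norm z < 1 \<Longrightarrow> (\<lambda>n. T n z) \<longlonglongrightarrow> 1"
    using blaschke_product_tails[OF B] by metis
  obtain K where hol: "(\<lambda>z. B z * G z) holomorphic_on ball 0 1"
    and K: "\<And>r. 0 < r \<Longrightarrow> r < 1 \<Longrightarrow> circle_mean p (\<lambda>z. B z * G z) r \<le> K"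
    using BG unfolding hardy_space_iff by blast
  have TG: "(\<lambda>z. T n z * G z) holomorphic_on ball 0 1" for n by (intro holomorphic_intros T G)
  have "circle_mean p G r \<le> K" if r: "0 < r" "r < 1" for r
  proof -
    have mean_eps: "circle_mean p (\<lambda>z. T n z * G z) r \<le> K / \<epsilon> powr p" if \<epsilon>: "0 < \<epsilon>" "\<epsilon> < 1" for n \<epsilon>
    proof -
      obtain \<rho> where \<rho>: "0 \<le> \<rho>" "\<rho> < 1"
        and P\<epsilon>: "\<And>z. \<rho> < norm z \<Longrightarrow> norm z < 1 \<Longrightarrow> \<epsilon> \<le> norm (P n z)"
        using norm_near_1_near_circle[OF P \<epsilon>(2)] by blast
      obtain R where R: "\<rho> < R" "R < 1"
        "circle_mean p (\<lambda>z. T n z * G z) r \<le> circle_mean p (\<lambda>z. T n z * G z) R"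
        using circle_mean_increasing[OF TG r p \<rho>] by blast
      have R0: "0 < R" using R \<rho> by simp
      note R(3)
      also have "circle_mean p (\<lambda>z. T n z * G z) R \<le> circle_mean p (\<lambda>z. B z * G z / of_real \<epsilon>) R"
      proof (rule circle_mean_mono[OF TG _ R0 R(2) p])
        show "(\<lambda>z. B z * G z / of_real \<epsilon>) holomorphic_on ball 0 1"
          using \<epsilon> by (intro holomorphic_intros hol) auto
        fix z :: complex assume "norm z = R"
        hence z: "norm z < 1" "\<epsilon> \<le> norm (P n z)" using R P\<epsilon>[of z] by auto
        have "\<epsilon> * norm (T n z * G z) \<le> norm (P n z) * norm (T n z * G z)"
          using z by (intro mult_right_mono) auto
        thus "norm (T n z * G z) \<le> norm (B z * G z / of_real \<epsilon>)"
          unfolding PT[OF z(1), of n] using \<epsilon>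
          by (simp add: norm_mult norm_divide pos_le_divide_eq mult_ac)
      qed
      also have "\<dots> = circle_mean p (\<lambda>z. B z * G z) R / \<epsilon> powr p"
        by (rule circle_mean_divide[OF \<epsilon>(1)])
      also have "\<dots> \<le> K / \<epsilon> powr p"
        by (intro divide_right_mono K R0 R) auto
      finally show ?thesis .
    qed
    have mean_TG: "circle_mean p (\<lambda>z. T n z * G z) r \<le> K" for n
    proof (rule tendsto_lowerbound)
      have "((\<lambda>\<epsilon>. K / \<epsilon> powr p) \<longlongrightarrow> K / 1 powr p) (at_left 1)"
        by (intro tendsto_intros) auto
      thus "((\<lambda>\<epsilon>. K / \<epsilon> powr p) \<longlongrightarrow> K) (at_left 1)" by simp
      show "\<forall>\<^sub>F \<epsilon> in at_left 1. circle_mean p (\<lambda>z. T n z * G z) r \<le> K / \<epsilon> powr p"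
        using eventually_at_left_real[of 0 "1::real"] by (auto elim!: eventually_mono intro: mean_eps)
    qed auto
    have "(\<lambda>n. integral {0..2 * pi} (\<lambda>t. norm (T n (of_real r * cis t) * G (of_real r * cis t)) powr p))
            \<longlonglongrightarrow> integral {0..2 * pi} (\<lambda>t. norm (G (of_real r * cis t)) powr p)"
    proof (rule dominated_convergence(2))
      show "(\<lambda>t. norm (T n (of_real r * cis t) * G (of_real r * cis t)) powr p) integrable_on {0..2 * pi}" for n
        using continuous_on_circle_powr[OF TG r p] by (intro integrable_continuous_interval) auto
      show "(\<lambda>t. norm (G (of_real r * cis t)) powr p) integrable_on {0..2 * pi}"
        by (intro integrable_continuous_interval continuous_on_circle_powr G r p)
      fix t
      have z: "norm (of_real r * cis t) < 1" using r by simp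
      show "norm (norm (T n (of_real r * cis t) * G (of_real r * cis t)) powr p)
              \<le> norm (G (of_real r * cis t)) powr p" for n
        using T(2)[OF z, of n] p by (auto simp: norm_mult intro!: powr_mono2 mult_left_le_one_le)
      have "(\<lambda>n. norm (T n (of_real r * cis t) * G (of_real r * cis t)) powr p)
              \<longlonglongrightarrow> norm (1 * G (of_real r * cis t)) powr p"
        using p by (intro tendsto_powr' tendsto_intros T_lim z) auto
      thus "(\<lambda>n. norm (T n (of_real r * cis t) * G (of_real r * cis t)) powr p)
              \<longlonglongrightarrow> norm (G (of_real r * cis t)) powr p" by simp
    qed
    hence "(\<lambda>n. circle_mean p (\<lambda>z. T n z * G z) r) \<longlonglongrightarrow> circle_mean p G r"
      unfolding circle_mean_def by (intro tendsto_intros)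
    thus ?thesis using mean_TG by (intro LIMSEQ_le_const2) auto
  qed
  thus ?thesis using G unfolding hardy_space_iff by blast
qed

lemma blaschke_product_holomorphic_bounded_nonzero:
  assumes "blaschke_product B"
  shows "B holomorphic_on ball 0 1" "norm z < 1 \<Longrightarrow> norm (B z) \<le> 1" "\<exists>z\<in>ball 0 1. B z \<noteq> 0"
proof -
  obtain P T :: "nat \<Rightarrow> complex \<Rightarrow> complex" where
    P: "P 0 holomorphic_on ball 0 1" "\<And>z. norm z \<le> 1 \<Longrightarrow> norm (P 0 z) \<le> 1"
    and T: "T 0 holomorphic_on ball 0 1" "\<And>z. norm z < 1 \<Longrightarrow> norm (T 0 z) \<le> 1"
    and PT: "\<And>z. norm z < 1 \<Longrightarrow> B z = P 0 z * T 0 z"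
    and nz: "\<exists>z\<in>ball 0 1. B z \<noteq> 0"
    using blaschke_product_tails[OF assms] by metis
  have "(\<lambda>z. P 0 z * T 0 z) holomorphic_on ball 0 1" by (intro holomorphic_intros P T)
  thus "B holomorphic_on ball 0 1" by (rule holomorphic_transform) (use PT in auto)
  show "norm (B z) \<le> 1" if "norm z < 1"
    using that by (auto simp: PT norm_mult intro!: mult_le_one P T)
  show "\<exists>z\<in>ball 0 1. B z \<noteq> 0" by (rule nz)
qed

theorem proposition3p4:
  fixes p :: real and B\<^sub>1 B\<^sub>2 \<phi> :: "complex \<Rightarrow> complex"
  assumes "0 < p"
    and "blaschke_product B\<^sub>1" and "blaschke_product B\<^sub>2"
    and "\<phi> holomorphic_on ball 0 1" and "\<phi> ` ball 0 1 \<subseteq> ball 0 1"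
  shows "composition_operator \<phi> ` blaschke_hardy B\<^sub>1 p \<subseteq> blaschke_hardy B\<^sub>2 p \<longleftrightarrow>
         (\<forall>w\<in>disk_zeros B\<^sub>2. zero_mult B\<^sub>2 w \<le> zero_mult (B\<^sub>1 \<circ> \<phi>) w)"
proof -
  note B1 = blaschke_product_holomorphic_bounded_nonzero[OF assms(2)]
  note B2 = blaschke_product_holomorphic_bounded_nonzero[OF assms(3)]
  have \<phi>1: "norm (\<phi> z) < 1" if "norm z < 1" for z
    using assms(5) that by (auto simp: image_subset_iff)
  have B1\<phi>: "(B\<^sub>1 \<circ> \<phi>) holomorphic_on ball 0 1"
    by (rule holomorphic_on_compose_gen[OF assms(4) B1(1) assms(5)])
  have "composition_operator \<phi> ` blaschke_hardy B\<^sub>1 p \<subseteq> blaschke_hardy B\<^sub>2 p \<longleftrightarrow>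
      (\<exists>Q. Q holomorphic_on ball 0 1 \<and> (\<forall>z\<in>ball 0 1. (B\<^sub>1 \<circ> \<phi>) z = B\<^sub>2 z * Q z))"
  proof
    assume sub: "composition_operator \<phi> ` blaschke_hardy B\<^sub>1 p \<subseteq> blaschke_hardy B\<^sub>2 p"
    have "(\<lambda>_. 1) \<in> hardy_space p"
      unfolding hardy_space_iff by (auto simp: circle_mean_def)
    hence "B\<^sub>1 \<in> blaschke_hardy B\<^sub>1 p"
      unfolding blaschke_hardy_def by auto
    hence "B\<^sub>1 \<circ> \<phi> \<in> blaschke_hardy B\<^sub>2 p"
      using sub by (auto simp: composition_operator_def)
    then obtain Q where "Q \<in> hardy_space p" "\<forall>z\<in>ball 0 1. (B\<^sub>1 \<circ> \<phi>) z = B\<^sub>2 z * Q z"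
      unfolding blaschke_hardy_def by blast
    thus "\<exists>Q. Q holomorphic_on ball 0 1 \<and> (\<forall>z\<in>ball 0 1. (B\<^sub>1 \<circ> \<phi>) z = B\<^sub>2 z * Q z)"
      unfolding hardy_space_iff by blast
  next
    assume "\<exists>Q. Q holomorphic_on ball 0 1 \<and> (\<forall>z\<in>ball 0 1. (B\<^sub>1 \<circ> \<phi>) z = B\<^sub>2 z * Q z)"
    then obtain Q where Q: "Q holomorphic_on ball 0 1"
      "\<And>z. z \<in> ball 0 1 \<Longrightarrow> (B\<^sub>1 \<circ> \<phi>) z = B\<^sub>2 z * Q z" by blast
    show "composition_operator \<phi> ` blaschke_hardy B\<^sub>1 p \<subseteq> blaschke_hardy B\<^sub>2 p"
    proof (rule image_subsetI)
      fix g assume "g \<in> blaschke_hardy B\<^sub>1 p"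
      then obtain f where f: "f \<in> hardy_space p" "\<And>z. z \<in> ball 0 1 \<Longrightarrow> g z = B\<^sub>1 z * f z"
        unfolding blaschke_hardy_def by blast
      have f\<phi>: "f \<circ> \<phi> \<in> hardy_space p"
        by (rule Littlewood_subordination[OF f(1) assms(1,4,5)])
      then obtain K where hol: "(f \<circ> \<phi>) holomorphic_on ball 0 1"
        and K: "\<And>r. 0 < r \<Longrightarrow> r < 1 \<Longrightarrow> circle_mean p (f \<circ> \<phi>) r \<le> K"
        unfolding hardy_space_iff by blast
      define G where "G = (\<lambda>z. Q z * (f \<circ> \<phi>) z)"
      have G: "G holomorphic_on ball 0 1" unfolding G_def by (intro holomorphic_intros Q hol)
      have BG: "B\<^sub>2 z * G z = B\<^sub>1 (\<phi> z) * f (\<phi> z)" if "norm z < 1" for z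
        using Q(2)[of z] that by (simp add: G_def)
      have BGhol: "(\<lambda>z. B\<^sub>2 z * G z) holomorphic_on ball 0 1" by (intro holomorphic_intros B2 G)
      have "circle_mean p (\<lambda>z. B\<^sub>2 z * G z) r \<le> K" if r: "0 < r" "r < 1" for r
      proof -
        have "circle_mean p (\<lambda>z. B\<^sub>2 z * G z) r \<le> circle_mean p (f \<circ> \<phi>) r"
        proof (rule circle_mean_mono[OF BGhol hol r assms(1)])
          fix z :: complex assume "norm z = r"
          hence z: "norm z < 1" using r by simp
          show "norm (B\<^sub>2 z * G z) \<le> norm ((f \<circ> \<phi>) z)"
            unfolding BG[OF z] using B1(2)[OF \<phi>1[OF z]]
            by (simp add: norm_mult mult_left_le_one_le)
        qed
        thus ?thesis using K[OF r] by linarith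
      qed
      hence "(\<lambda>z. B\<^sub>2 z * G z) \<in> hardy_space p"
        unfolding hardy_space_iff using BGhol by blast
      hence "G \<in> hardy_space p" by (rule Riesz_division[OF assms(3) G assms(1)])
      moreover have "composition_operator \<phi> g z = B\<^sub>2 z * G z" if "z \<in> ball 0 1" for z
        using f(2)[of "\<phi> z"] BG[of z] \<phi>1[of z] that by (simp add: composition_operator_def)
      ultimately show "composition_operator \<phi> g \<in> blaschke_hardy B\<^sub>2 p"
        unfolding blaschke_hardy_def by blast
    qed
  qed
  also have "\<dots> \<longleftrightarrow> (\<forall>w\<in>disk_zeros B\<^sub>2. zero_mult B\<^sub>2 w \<le> zero_mult (B\<^sub>1 \<circ> \<phi>) w)"
    by (rule zero_mult_le_iff_divides[OF B1\<phi> B2(1,3), symmetric])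
  finally show ?thesis .
qed

end
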